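(* In the AMLI-cycle setting described in the context, assume that the two-grid method converges uniformly with convergence rate $\delta_{TG}$. Let $\widetilde p_k$ be a real polynomial with $\widetilde p_k(0)=1$ for which there exists $0<\widetilde\nu<1$ such that (i) $\widetilde p_k(\widetilde\nu)\ge 0$; (ii) $\widetilde p_k$ is decreasing on $(0,\widetilde\nu]$; (iii) $\widetilde p_k(\widetilde\nu)\ge\max_{\widetilde x\in[\widetilde\nu,1]}\widetilde p_k(\widetilde x)$; and fix such a $\widetilde\nu$. Set $$L=\max\Big\{1,\ 1-\min_{\widetilde x\in(0,1]}\widetilde p_k(\widetilde x)\Big\},\qquad p_k(x)=\widetilde p_k\left(\frac xL\right).$$ Then the AMLI operators $B_\ell$ defined with the polynomial $p=p_k$ satisfy the condition number estimate $$\kappa(B_\ell A_\ell)\le\frac L\mu\quad\text{for all levels }\ell,$$ provided that there exists $0<\mu\le\bar\mu:=\min\{L\widetilde\nu,\,1-\delta_{TG}\}$ satisfying $$\mu\le(1-\delta_{TG})\left[1-p_k(\mu)\right].$$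
   Context: AMLI-cycle setting. SPD means symmetric positive definite. Let $J\ge 2$ be the number of levels. For $\ell=1,\dots,J$ let $A_\ell\in\mathbb{R}^{n_\ell\times n_\ell}$ be SPD, and for $\ell=1,\dots,J-1$ let $P_\ell\in\mathbb{R}^{n_\ell\times n_{\ell+1}}$ (prolongation) be such that $A_{\ell+1}=P_\ell^TA_\ell P_\ell$. For $\ell=1,\dots,J-1$ let $M_\ell\in\mathbb{R}^{n_\ell\times n_\ell}$ be a nonsingular matrix (smoother) which is nonexpansive: $\|I-M_\ell A_\ell\|_{A_\ell}\le 1$, where $\|\cdot\|_{A_\ell}$ is the operator norm induced by the inner product $(u,v)_{A_\ell}=(A_\ell u,v)$. Put $\overline{M}_\ell:=M_\ell^T(M_\ell^{-1}+M_\ell^{-T}-A_\ell)M_\ell=M_\ell+M_\ell^T-M_\ell^TA_\ell M_\ell$. Given a polynomial $p$ with $p(0)=1$, the AMLI operators are defined recursively from the coarsest level by $B_J=\widehat B_J=A_J^{-1}$, and $$B_\ell=\overline M_\ell+(I-M_\ell^TA_\ell)P_\ell\widehat B_{\ell+1}P_\ell^T(I-A_\ell M_\ell),\quad \ell=J-1,\dots,1,$$ $$\widehat B_\ell=(I-p(B_\ell A_\ell))A_\ell^{-1},\quad \ell=2,\dots,J-1.$$ The two-grid operator on level $\ell\le J-1$ is $B^{TG}_\ell=\overline M_\ell+(I-M_\ell^TA_\ell)P_\ell A_{\ell+1}^{-1}P_\ell^T(I-A_\ell M_\ell)$. "The two-grid method converges uniformly with convergence rate $\delta_{TG}$" means that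 $\delta_{TG}\in[0,1)$ and, for all $\ell=1,\dots,J-1$, $\lambda_{\min}(B_\ell^{TG}A_\ell)\ge 1-\delta_{TG}$ and $\lambda_{\max}(B_\ell^{TG}A_\ell)\le 1$. $\kappa(B_\ell A_\ell)=\lambda_{\max}(B_\ell A_\ell)/\lambda_{\min}(B_\ell A_\ell)$; a bound $\kappa(B_\ell A_\ell)\le C$ means that all eigenvalues of $B_\ell A_\ell$ are positive and $\lambda_{\max}\le C\lambda_{\min}$. *)

theory Defs
  imports
    "Jordan_Normal_Form.Gauss_Jordan_Elimination"
    "Jordan_Normal_Form.Spectral_Radius"
    "HOL-Computational_Algebra.Polynomial"
begin

(* Meaningful only for invertible matrices; on every other matrix the value is unspecified. *)
definition mat_inv :: "real mat \<Rightarrow> real mat" where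
  "mat_inv X = the (mat_inverse X)"

definition spd :: "nat \<Rightarrow> real mat \<Rightarrow> bool" where
  "spd n A \<longleftrightarrow> A \<in> carrier_mat n n \<and> A\<^sup>T = A \<and>
     (\<forall>v\<in>carrier_vec n. v \<noteq> 0\<^sub>v n \<longrightarrow> 0 < (A *\<^sub>v v) \<bullet> v)"

definition energy_norm :: "real mat \<Rightarrow> real vec \<Rightarrow> real" where
  "energy_norm A v = sqrt ((A *\<^sub>v v) \<bullet> v)"

(* As in onorm of HOL-Analysis, the vector 0 contributes 0/0 = 0, which does not affect the
   supremum of these nonnegative quotients (for positive dimension). *)
definition energy_opnorm :: "real mat \<Rightarrow> real mat \<Rightarrow> real" where
  "energy_opnorm A X =
     (SUP v\<in>carrier_vec (dim_col X). energy_norm A (X *\<^sub>v v) / energy_norm A v)"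

(* p(X) = sum of (coeff p k) X^k for a square matrix X, written entrywise because the matrix
   type carries no dimension and hence has no type-class sum. *)
definition poly_mat :: "real poly \<Rightarrow> real mat \<Rightarrow> real mat" where
  "poly_mat p X = mat (dim_row X) (dim_row X)
     (\<lambda>(i, j). \<Sum>k\<le>degree p. coeff p k * (X ^\<^sub>m k) $$ (i, j))"

(* The extreme real eigenvalues. They are used for products X = B * A with B symmetric and A SPD;
   such an X is self-adjoint in the A-inner product, so it has no other eigenvalues. *)
definition lambda_min :: "real mat \<Rightarrow> real" where
  "lambda_min X = Min (spectrum X)"

definition lambda_max :: "real mat \<Rightarrow> real" where
  "lambda_max X = Max (spectrum X)"

(* The bound lambda_max / lambda_min \<le> C. Positivity is required of all complex eigenvalues,
   so that it includes that they are real. *)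
definition kappa_le :: "real mat \<Rightarrow> real \<Rightarrow> bool" where
  "kappa_le X C \<longleftrightarrow>
     spectrum (map_mat complex_of_real X) \<subseteq> complex_of_real ` {0<..} \<and>
     lambda_max X \<le> C * lambda_min X"

definition Mbar :: "real mat \<Rightarrow> real mat \<Rightarrow> real mat" where
  "Mbar A M = M\<^sup>T * (mat_inv M + (mat_inv M)\<^sup>T - A) * M"

(* One symmetrized cycle with smoother M, prolongation P and coarse solver C. *)
definition cycle_op :: "real mat \<Rightarrow> real mat \<Rightarrow> real mat \<Rightarrow> real mat \<Rightarrow> real mat" where
  "cycle_op A M P C =
     Mbar A M +
     (1\<^sub>m (dim_row A) - M\<^sup>T * A) * P * C * P\<^sup>T * (1\<^sub>m (dim_row A) - A * M)"

definition two_grid_op ::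
    "(nat \<Rightarrow> real mat) \<Rightarrow> (nat \<Rightarrow> real mat) \<Rightarrow> (nat \<Rightarrow> real mat) \<Rightarrow> nat \<Rightarrow> real mat" where
  "two_grid_op A M P l = cycle_op (A l) (M l) (P l) (mat_inv (A (Suc l)))"

definition two_grid_uniform ::
    "nat \<Rightarrow> (nat \<Rightarrow> real mat) \<Rightarrow> (nat \<Rightarrow> real mat) \<Rightarrow> (nat \<Rightarrow> real mat) \<Rightarrow> real \<Rightarrow> bool" where
  "two_grid_uniform J A M P \<delta> \<longleftrightarrow>
     \<delta> \<in> {0..<1} \<and>
     (\<forall>l\<in>{1..<J}. 1 - \<delta> \<le> lambda_min (two_grid_op A M P l * A l) \<and>
                   lambda_max (two_grid_op A M P l * A l) \<le> 1)"

(* Levels run from 1 (finest) to J (coarsest); the values for l > J are irrelevant. *)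
function
  amli_B :: "nat \<Rightarrow> (nat \<Rightarrow> real mat) \<Rightarrow> (nat \<Rightarrow> real mat) \<Rightarrow> (nat \<Rightarrow> real mat) \<Rightarrow>
    real poly \<Rightarrow> nat \<Rightarrow> real mat" and
  amli_Bhat :: "nat \<Rightarrow> (nat \<Rightarrow> real mat) \<Rightarrow> (nat \<Rightarrow> real mat) \<Rightarrow> (nat \<Rightarrow> real mat) \<Rightarrow>
    real poly \<Rightarrow> nat \<Rightarrow> real mat"
where
  "amli_B J A M P p l =
     (if l < J then cycle_op (A l) (M l) (P l) (amli_Bhat J A M P p (Suc l))
      else mat_inv (A l))"
| "amli_Bhat J A M P p l =
     (if l < J then
        (1\<^sub>m (dim_row (A l)) - poly_mat p (amli_B J A M P p l * A l)) * mat_inv (A l)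
      else mat_inv (A l))"
  by pat_completeness auto
termination
  by (relation "measure (\<lambda>x. case x of
        Inl (J, _, _, _, _, l) \<Rightarrow> 2 * (J - l)
      | Inr (J, _, _, _, _, l) \<Rightarrow> Suc (2 * (J - l)))") auto

declare amli_B.simps [simp del] amli_Bhat.simps [simp del]

end

theory Submission
  imports Defs
begin

text \<open>
  Both the hypothesis on the two-grid method and the claim are statements about the eigenvalues of
  products \<open>B * A\<close> with \<open>B\<close> symmetric and \<open>A\<close> symmetric positive definite. The spectral theorem
  turns \<open>spectrum (B * A) \<subseteq> {a..b}\<close> into the comparison of quadratic forms
  \<open>a (A\<inverse> u, u) \<le> (B u, u) \<le> b (A\<inverse> u, u)\<close>, and for such comparisons the AMLI recursion is easy to
  follow. Write \<open>[a, b]\<close> for this property of \<open>B\<close> relative to the matrix \<open>A\<close> of its level, and let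
  \<open>c = 1 - p \<mu>\<close>.

  \<^item> Polynomial step: if \<open>B\<close> satisfies \<open>[\<mu>, L]\<close>, then the eigenvalues of the corrected operator
    times \<open>A\<close> are the values \<open>1 - p x\<close> at eigenvalues \<open>x\<close> in \<open>{\<mu>..L}\<close>. The scaling by \<open>L\<close> gives
    \<open>1 - p x \<le> L\<close>, and the shape of the polynomial gives \<open>p x \<le> p \<mu>\<close>, so the corrected operator
    satisfies \<open>[c, L]\<close> (\<open>correction_polynomial_bounds\<close>, \<open>spectral_bounds_polynomial_correction\<close>).

  \<^item> Cycle step: the form of a cycle is the form of its smoothing part plus the form of its
    coarse solver at the restricted residual. The smoothing part is nonnegative because the smoother
    is nonexpansive. Since \<open>c \<le> 1 \<le> L\<close>, a coarse solver that lies between \<open>c\<close> times and \<open>L\<close> times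
    the exact one produces a cycle between \<open>c\<close> times and \<open>L\<close> times the two-grid operator
    (\<open>cycle_op_spectral_bounds\<close>).

  The two-grid operator satisfies \<open>[1 - \<delta>, 1]\<close>, so the cycle satisfies \<open>[c (1 - \<delta>), L]\<close>, and the
  condition on \<open>\<mu>\<close> says exactly that \<open>\<mu> \<le> c (1 - \<delta>)\<close>. Hence \<open>[\<mu>, L]\<close> passes from each level to
  the next finer one. On the coarsest level the solver is exact and \<open>\<mu> \<le> 1 \<le> L\<close>.
\<close>

section \<open>Orthogonal diagonalization of real symmetric matrices\<close>

text \<open>
  A Householder reflection exchanges the first unit vector with a given unit vector. It serves to
  complete an eigenvector to an orthonormal basis.
\<close>

lemma householder:
  fixes v :: "real vec"
  assumes v: "v \<in> carrier_vec n" and n: "0 < n" and unit: "v \<bullet> v = 1"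
  obtains H where "H \<in> carrier_mat n n" "H\<^sup>T = H" "H * H = 1\<^sub>m n" "col H 0 = v"
proof (cases "v $ 0 = 1")
  case True
  have "v \<bullet> v = (\<Sum>i\<in>{0..<n}. (v $ i)\<^sup>2)"
    using v by (simp add: scalar_prod_def power2_eq_square)
  also have "\<dots> = 1 + (\<Sum>i\<in>{0..<n} - {0}. (v $ i)\<^sup>2)"
    using n True by (subst sum.remove[of _ 0]) auto
  finally have "(\<Sum>i\<in>{0..<n} - {0}. (v $ i)\<^sup>2) = 0" using unit by simp
  then have "\<forall>i\<in>{0..<n} - {0}. (v $ i)\<^sup>2 = 0"
    by (subst (asm) sum_nonneg_eq_0_iff) auto
  then have "v = unit_vec n 0" using v n True by (intro eq_vecI) (auto simp: unit_vec_def)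
  then show ?thesis using n by (intro that[of "1\<^sub>m n"]) auto
next
  case False
  \<comment> \<open>The reflection is \<open>1 - 2 w w\<^sup>T / (w \<bullet> w)\<close>, and \<open>w \<bullet> w = 2 (1 - v $ 0)\<close>.\<close>
  define w where "w = v - unit_vec n 0"
  define c where "c = 1 / (1 - v $ 0)"
  define H where "H = mat n n (\<lambda>(i, j). (if i = j then 1 else 0) - c * w $ i * w $ j)"
  have w: "w \<in> carrier_vec n" using v by (simp add: w_def)
  have c: "c * (1 - v $ 0) = 1" using False by (simp add: c_def)
  have "w \<bullet> w = v \<bullet> v - 2 * v $ 0 + 1"
    using v n unfolding w_def
    by (simp add: minus_scalar_prod_distrib[of _ n] scalar_prod_minus_distrib[of _ n])
  then have ww: "(\<Sum>k\<in>{0..<n}. w $ k * w $ k) = 2 - 2 * v $ 0"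
    using unit w by (simp add: scalar_prod_def)
  have H: "H \<in> carrier_mat n n" by (simp add: H_def)
  have sym: "H\<^sup>T = H" by (intro eq_matI) (auto simp: H_def)
  have col: "col H 0 = v"
  proof (intro eq_vecI)
    fix i assume i: "i < dim_vec v"
    have w0: "c * w $ 0 = -1" using c n v by (simp add: w_def algebra_simps)
    have "H $$ (i, 0) = (if i = 0 then 1 else 0) - w $ i * (c * w $ 0)"
      using i v n by (simp add: H_def)
    also have "\<dots> = v $ i" unfolding w0 using i v n by (auto simp: w_def unit_vec_def)
    finally show "col H 0 $ i = v $ i" using H i n v by auto
  qed (use H v in auto)
  have "H * H = 1\<^sub>m n"
  proof (intro eq_matI)
    fix i j assume ij: "i < dim_row (1\<^sub>m n :: real mat)" "j < dim_col (1\<^sub>m n :: real mat)"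
    have "(H * H) $$ (i, j) = (\<Sum>k\<in>{0..<n}. ((if i = k then 1 else 0) - c * w $ i * w $ k)
        * ((if k = j then 1 else 0) - c * w $ k * w $ j))"
      using ij by (simp add: H_def scalar_prod_def)
    also have "\<dots> = (\<Sum>k\<in>{0..<n}. (if i = k then (if i = j then 1 else 0) else 0)
        - (if i = k then c * w $ i * w $ j else 0) - (if k = j then c * w $ i * w $ j else 0)
        + c * c * w $ i * w $ j * (w $ k * w $ k))"
      by (intro sum.cong) (auto simp: algebra_simps)
    also have "\<dots> = (if i = j then 1 else 0) - 2 * c * w $ i * w $ j
        + c * c * w $ i * w $ j * (2 - 2 * v $ 0)"
      using ij by (simp add: sum.distrib sum_subtractf sum_distrib_left[symmetric] ww)
    also have "\<dots> = (if i = j then 1 else 0) - 2 * c * w $ i * w $ j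
        + 2 * c * w $ i * w $ j * (c * (1 - v $ 0))" by (simp add: algebra_simps)
    finally show "(H * H) $$ (i, j) = 1\<^sub>m n $$ (i, j)" unfolding c using ij by simp
  qed (use H in auto)
  with H sym col show ?thesis by (intro that)
qed

text \<open>
  Over the complex numbers some eigenvalue exists. It is real because it equals its conjugate, as
  one sees by moving the symmetric matrix from one side of the Hermitian product to the other.
  Being a root of the real characteristic polynomial, it then has a real eigenvector.
\<close>
lemma symmetric_real_eigenvector:
  fixes S :: "real mat"
  assumes S: "S \<in> carrier_mat n n" and sym: "S\<^sup>T = S" and n: "0 < n"
  obtains e v where "v \<in> carrier_vec n" "v \<bullet> v = 1" "S *\<^sub>v v = e \<cdot>\<^sub>v v"
proof -
  let ?C = "map_mat complex_of_real S"
  have C: "?C \<in> carrier_mat n n" using S by simp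
  obtain k where k: "eigenvalue ?C k"
    using spectrum_non_empty[OF C n] unfolding spectrum_def by auto
  then obtain z where z: "z \<in> carrier_vec n" "z \<noteq> 0\<^sub>v n" and Cz: "?C *\<^sub>v z = k \<cdot>\<^sub>v z"
    using C unfolding eigenvalue_def eigenvector_def by auto
  have cz: "conjugate z \<in> carrier_vec n" using z by simp
  have Ccz: "?C *\<^sub>v conjugate z = conjugate (?C *\<^sub>v z)"
    using S z by (intro eq_vecI) (auto simp: scalar_prod_def)
  have "k * (z \<bullet> conjugate z) = (?C *\<^sub>v z) \<bullet> conjugate z"
    using z Cz by simp
  also have "\<dots> = z \<bullet> (?C *\<^sub>v conjugate z)"
    using transpose_vec_mult_scalar[OF C cz z(1)] sym map_mat_transpose[of complex_of_real S] by simp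
  also have "\<dots> = cnj k * (z \<bullet> conjugate z)"
    using z Cz by (simp add: Ccz conjugate_smult_vec)
  finally have "k = cnj k"
    using z conjugate_square_eq_0_vec[OF z(1)] by simp
  then obtain e where e: "k = complex_of_real e"
    by (metis Reals_cnj_iff Reals_cases)
  have "poly (char_poly ?C) k = complex_of_real (poly (char_poly S) e)"
    by (simp add: e of_real_hom.char_poly_hom[OF S])
  then have "eigenvalue S e"
    using k eigenvalue_root_char_poly[OF C] eigenvalue_root_char_poly[OF S] by simp
  then obtain u where u: "u \<in> carrier_vec n" "u \<noteq> 0\<^sub>v n" and Su: "S *\<^sub>v u = e \<cdot>\<^sub>v u"
    using S unfolding eigenvalue_def eigenvector_def by auto
  define r where "r = 1 / sqrt (u \<bullet> u)"
  have uu: "u \<bullet> u > 0" using conjugate_square_greater_0_vec[OF u(1)] u by simp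
  show ?thesis
  proof (rule that[of "r \<cdot>\<^sub>v u" e])
    show "r \<cdot>\<^sub>v u \<in> carrier_vec n" using u by simp
    have "r * r * (u \<bullet> u) = 1" using uu by (simp add: r_def)
    then show "(r \<cdot>\<^sub>v u) \<bullet> (r \<cdot>\<^sub>v u) = 1" using u by (simp add: algebra_simps)
    show "S *\<^sub>v (r \<cdot>\<^sub>v u) = e \<cdot>\<^sub>v (r \<cdot>\<^sub>v u)"
      using S u Su by (simp add: mult_mat_vec smult_smult_assoc mult.commute)
  qed
qed


text \<open>
  Conjugation with the reflection \<open>H\<close> that maps the first unit vector to an eigenvector splits off
  a one-by-one block: the first column of \<open>H * S * H\<close> vanishes below the diagonal, and by symmetry
  so does the first row to the right of it.
\<close>
theorem symmetric_orthogonal_diagonalization: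
  fixes S :: "real mat"
  assumes "S \<in> carrier_mat n n" and "S\<^sup>T = S"
  shows "\<exists>U d. U \<in> carrier_mat n n \<and> U\<^sup>T * U = 1\<^sub>m n \<and> U\<^sup>T * S * U = mat_diag n d"
  using assms
proof (induction n arbitrary: S)
  case 0
  have "1\<^sub>m 0 * S * 1\<^sub>m 0 = mat_diag 0 (\<lambda>_. 0)"
    using 0 by (intro eq_matI) (auto simp: mat_diag_def)
  then show ?case by (intro exI[of _ "1\<^sub>m 0"] exI[of _ "\<lambda>_. 0"]) auto
next
  case (Suc n)
  let ?N = "Suc n"
  note assoc = assoc_mult_mat[of _ ?N ?N _ ?N _ ?N]
  note S = Suc.prems(1) and sym = Suc.prems(2)
  obtain e v where v: "v \<in> carrier_vec ?N" "v \<bullet> v = 1" and Sv: "S *\<^sub>v v = e \<cdot>\<^sub>v v"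
    using symmetric_real_eigenvector[OF S sym] by blast
  obtain H where H: "H \<in> carrier_mat ?N ?N" "H\<^sup>T = H" and HH: "H * H = 1\<^sub>m ?N" and col: "col H 0 = v"
    using householder[OF v(1) _ v(2)] by blast
  define T where "T = H * S * H"
  have T: "T \<in> carrier_mat ?N ?N" using H S by (simp add: T_def)
  have Tsym: "T\<^sup>T = T"
    using H S sym by (simp add: T_def transpose_mult[of _ ?N ?N _ ?N] assoc)
  have "col T 0 = H *\<^sub>v (S *\<^sub>v v)"
    using H S col by (simp add: T_def col_mult2[of _ ?N ?N _ ?N] del: col_mult)
  also have "\<dots> = e \<cdot>\<^sub>v (H *\<^sub>v v)" using H v Sv by (simp add: mult_mat_vec)
  also have "H *\<^sub>v v = col (H * H) 0" using H col by (simp add: col_mult2[of _ ?N ?N _ ?N] del: col_mult)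
  finally have col0: "col T 0 = e \<cdot>\<^sub>v unit_vec ?N 0" using HH by simp
  have T_0: "T $$ (i, 0) = (if i = 0 then e else 0)" if "i < ?N" for i
    using arg_cong[OF col0, of "\<lambda>w. w $ i"] that T by auto
  have T_sw: "T $$ (i, j) = T $$ (j, i)" if "i < ?N" "j < ?N" for i j
    using arg_cong[OF Tsym, of "\<lambda>X. X $$ (i, j)"] that T by simp
  define R where "R = mat n n (\<lambda>(i, j). T $$ (Suc i, Suc j))"
  define E where "E = mat 1 1 (\<lambda>_ :: nat \<times> nat. e)"
  have R: "R \<in> carrier_mat n n" and E: "E \<in> carrier_mat 1 1" by (auto simp: R_def E_def)
  have "R\<^sup>T = R" by (intro eq_matI) (auto simp: R_def T_sw)
  from Suc.IH[OF R this] obtain U d where U: "U \<in> carrier_mat n n" and UU: "U\<^sup>T * U = 1\<^sub>m n"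
    and UR: "U\<^sup>T * R * U = mat_diag n d" by blast
  have T_block: "T = four_block_mat E (0\<^sub>m 1 n) (0\<^sub>m n 1) R"
    using T R E T_0 T_sw[of 0] by (intro eq_matI) (auto simp: R_def E_def)
  define K where "K = four_block_mat (1\<^sub>m 1) (0\<^sub>m 1 n) (0\<^sub>m n 1) U"
  have K: "K \<in> carrier_mat ?N ?N"
    using four_block_carrier_mat[OF one_carrier_mat[of 1] U] by (simp add: K_def)
  have KT: "K\<^sup>T = four_block_mat (1\<^sub>m 1) (0\<^sub>m 1 n) (0\<^sub>m n 1) U\<^sup>T"
    unfolding K_def by (subst transpose_four_block_mat[of _ 1 1 _ n _ n]) (use U in auto)
  have "K\<^sup>T * K = four_block_mat (1\<^sub>m 1) (0\<^sub>m 1 n) (0\<^sub>m n 1) (U\<^sup>T * U)"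
    unfolding KT unfolding K_def
    by (subst mult_four_block_mat[of _ 1 1 _ n _ n _ _ 1 _ n]) (use U in auto)
  then have KK: "K\<^sup>T * K = 1\<^sub>m ?N" by (simp add: UU)
  have TK: "T * K = four_block_mat E (0\<^sub>m 1 n) (0\<^sub>m n 1) (R * U)"
    unfolding T_block K_def
    by (subst mult_four_block_mat[of _ 1 1 _ n _ n _ _ 1 _ n]) (use U R E in auto)
  have "K\<^sup>T * (T * K) = four_block_mat E (0\<^sub>m 1 n) (0\<^sub>m n 1) (U\<^sup>T * (R * U))"
    unfolding KT TK
    by (subst mult_four_block_mat[of _ 1 1 _ n _ n _ _ 1 _ n]) (use U R E in auto)
  also have "U\<^sup>T * (R * U) = mat_diag n d"
    using UR U R by (simp add: assoc_mult_mat[of _ n n _ n _ n])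
  also have "four_block_mat E (0\<^sub>m 1 n) (0\<^sub>m n 1) (mat_diag n d)
      = mat_diag ?N (\<lambda>i. if i = 0 then e else d (i - 1))"
    using E by (intro eq_matI) (auto simp: mat_diag_def E_def)
  finally have KTK: "K\<^sup>T * (T * K) = mat_diag ?N (\<lambda>i. if i = 0 then e else d (i - 1))" .
  have HK_T: "(H * K)\<^sup>T = K\<^sup>T * H"
    using H K by (simp add: transpose_mult[of _ ?N ?N _ ?N])
  have "(H * K)\<^sup>T * (H * K) = K\<^sup>T * ((H * H) * K)"
    unfolding HK_T using H(1) K by (simp add: assoc)
  then have 1: "(H * K)\<^sup>T * (H * K) = 1\<^sub>m ?N" using HH KK K by simp
  have "(H * K)\<^sup>T * S * (H * K) = K\<^sup>T * (T * K)"
    unfolding HK_T T_def using H(1) K S by (simp add: assoc)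
  then have 2: "(H * K)\<^sup>T * S * (H * K) = mat_diag ?N (\<lambda>i. if i = 0 then e else d (i - 1))"
    using KTK by simp
  have 3: "H * K \<in> carrier_mat ?N ?N" using H K by simp
  from 1 2 3 show ?case by blast
qed

section \<open>Eigenbases orthonormal in the energy inner product\<close>
lemma mat_diag_transpose [simp]: "(mat_diag n f)\<^sup>T = mat_diag n f"
  by (intro eq_matI) (auto simp: mat_diag_def)

text \<open>
  The columns of \<open>V\<close> form a basis that is orthonormal for the inner product given by \<open>A\<close> and
  consists of eigenvectors of \<open>B * A\<close> with eigenvalues \<open>d\<close>. As \<open>V * V\<^sup>T\<close> is the inverse of \<open>A\<close>,
  the eigenvalue equations are equivalent to the symmetric form \<open>B = V * mat_diag n d * V\<^sup>T\<close>, which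
  shows the quadratic forms of \<open>B\<close> and of the inverse of \<open>A\<close> diagonalized by the same substitution
  \<open>y = V\<^sup>T u\<close>.
\<close>
locale energy_eigenbasis =
  fixes n :: nat and A V :: "real mat" and d :: "nat \<Rightarrow> real" and B :: "real mat"
  assumes spd: "spd n A"
    and V [simp]: "V \<in> carrier_mat n n"
    and orthonormal: "V\<^sup>T * A * V = 1\<^sub>m n"
    and B_eq: "B = V * mat_diag n d * V\<^sup>T"

text \<open>
  A first diagonalization rescales an orthonormal eigenbasis of \<open>A\<close> to \<open>W\<close> with
  \<open>W\<^sup>T * A * W = 1\<close>. In these coordinates the operator \<open>B * A\<close> is the symmetric matrix
  \<open>W\<^sup>T * A * B * A * W\<close>, and a rotation \<open>Q\<close> that diagonalizes it keeps \<open>W * Q\<close> orthonormal.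
\<close>
theorem energy_eigenbasis_exists:
  assumes spd: "spd n A" and B: "B \<in> carrier_mat n n" and B_sym: "B\<^sup>T = B"
  obtains V d where "energy_eigenbasis n A V d B"
proof -
  note assoc = assoc_mult_mat[of _ n n _ n _ n]
  note tr = transpose_mult[of _ n n _ n]
  have A: "A \<in> carrier_mat n n" and A_sym: "A\<^sup>T = A"
    and pos: "\<And>v. v \<in> carrier_vec n \<Longrightarrow> v \<noteq> 0\<^sub>v n \<Longrightarrow> 0 < (A *\<^sub>v v) \<bullet> v"
    using spd by (auto simp: spd_def)
  obtain U a where U: "U \<in> carrier_mat n n" and UU: "U\<^sup>T * U = 1\<^sub>m n"
    and UA: "U\<^sup>T * A * U = mat_diag n a"
    using symmetric_orthogonal_diagonalization[OF A A_sym] by blast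
  have a_pos: "0 < a i" if i: "i < n" for i
  proof -
    let ?u = "col U i"
    have u: "?u \<in> carrier_vec n" using U i by simp
    have "?u \<bullet> ?u = (U\<^sup>T * U) $$ (i, i)" using U i by simp
    then have "?u \<noteq> 0\<^sub>v n" using UU u i by auto
    moreover have "(U\<^sup>T * (A * U)) $$ (i, i) = ?u \<bullet> (A *\<^sub>v ?u)"
      using U A i by (simp add: col_mult2[of _ n n _ n] del: col_mult)
    moreover have "?u \<bullet> (A *\<^sub>v ?u) = (A *\<^sub>v ?u) \<bullet> ?u"
      using A u by (intro comm_scalar_prod[of _ n]) auto
    moreover have "(U\<^sup>T * (A * U)) $$ (i, i) = a i"
      using UA U A i by (simp add: assoc) (simp add: mat_diag_def)
    ultimately show ?thesis using pos[OF u] by simp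
  qed
  define r where "r = (\<lambda>i. 1 / sqrt (a i))"
  define W where "W = U * mat_diag n r"
  have W: "W \<in> carrier_mat n n" using U by (simp add: W_def)
  have "W\<^sup>T * A * W = mat_diag n r * (U\<^sup>T * A * U) * mat_diag n r"
    using U A by (simp add: W_def tr assoc)
  also have "\<dots> = mat_diag n (\<lambda>i. r i * a i * r i)" by (simp add: UA)
  also have "\<dots> = 1\<^sub>m n"
  proof -
    have "r i * a i * r i = 1" if "i < n" for i
      using a_pos[OF that] by (simp add: r_def)
    then show ?thesis by (intro eq_matI) (auto simp: mat_diag_def)
  qed
  finally have WAW: "W\<^sup>T * A * W = 1\<^sub>m n" .
  define C where "C = W\<^sup>T * A * B * A * W"
  have C: "C \<in> carrier_mat n n" using W A B by (simp add: C_def mult_carrier_mat[of _ n n _ n])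
  have "C\<^sup>T = C" using W A B by (simp add: C_def tr assoc A_sym B_sym)
  then obtain Q d where Q: "Q \<in> carrier_mat n n" and QQ: "Q\<^sup>T * Q = 1\<^sub>m n"
    and QC: "Q\<^sup>T * C * Q = mat_diag n d"
    using symmetric_orthogonal_diagonalization[OF C] by blast
  define V where "V = W * Q"
  have V: "V \<in> carrier_mat n n" using W Q by (simp add: V_def)
  have "V\<^sup>T * A * V = Q\<^sup>T * (W\<^sup>T * A * W) * Q" using W Q A by (simp add: V_def tr assoc)
  also have "\<dots> = 1\<^sub>m n" using Q QQ by (simp add: WAW)
  finally have VAV: "V\<^sup>T * A * V = 1\<^sub>m n" .
  have VVA: "V * (V\<^sup>T * A) = 1\<^sub>m n"
    using mat_mult_left_right_inverse[OF _ V VAV] V A by simp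
  have "A * (V * V\<^sup>T) = (V * (V\<^sup>T * A))\<^sup>T" using V A by (simp add: tr assoc A_sym)
  then have AVV: "A * (V * V\<^sup>T) = 1\<^sub>m n" by (simp add: VVA)
  have "V * mat_diag n d * V\<^sup>T = (V * (V\<^sup>T * A)) * B * (A * (V * V\<^sup>T))"
    unfolding QC[symmetric] C_def V_def using W Q A B by (simp add: tr assoc)
  then have "B = V * mat_diag n d * V\<^sup>T" using B by (simp add: VVA AVV)
  with spd V VAV have "energy_eigenbasis n A V d B" by unfold_locales
  then show ?thesis by (rule that)
qed

section \<open>Inverses and functions of diagonalized matrices\<close>
lemma mat_inv_eqI:
  assumes X: "X \<in> carrier_mat n n" and Y: "Y \<in> carrier_mat n n" and XY: "X * Y = 1\<^sub>m n"
  shows "mat_inv X = Y"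
proof -
  have YX: "Y * X = 1\<^sub>m n" using mat_mult_left_right_inverse[OF X Y XY] .
  have "X \<in> Units (ring_mat TYPE(real) n ())"
    using X Y XY YX by (auto simp: Units_def ring_mat_simps)
  then obtain Z where Z: "mat_inverse X = Some Z"
    using mat_inverse(1)[OF X, of "()"] by (cases "mat_inverse X") auto
  have ZX: "Z * X = 1\<^sub>m n" and Zc: "Z \<in> carrier_mat n n"
    using mat_inverse(2)[OF X Z] by auto
  have "Z = Z * (X * Y)" using Zc by (simp add: XY)
  also have "\<dots> = Y" using ZX Zc X Y by (simp flip: assoc_mult_mat[of _ n n _ n _ n])
  finally show ?thesis using Z by (simp add: mat_inv_def)
qed

lemma mat_inv_right_left:
  assumes X: "X \<in> carrier_mat n n" and inv: "invertible_mat X"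
  shows "mat_inv X \<in> carrier_mat n n" and "X * mat_inv X = 1\<^sub>m n" and "mat_inv X * X = 1\<^sub>m n"
proof -
  obtain Y where XY: "X * Y = 1\<^sub>m n" and YX: "Y * X = 1\<^sub>m (dim_row Y)"
    using inv X by (auto simp: invertible_mat_def inverts_mat_def)
  have Y: "Y \<in> carrier_mat n n"
    using arg_cong[OF XY, of dim_col] arg_cong[OF YX, of dim_col] X by auto
  have "mat_inv X = Y" by (rule mat_inv_eqI[OF X Y XY])
  then show "mat_inv X \<in> carrier_mat n n" "X * mat_inv X = 1\<^sub>m n" "mat_inv X * X = 1\<^sub>m n"
    using XY YX Y by auto
qed

lemma sandwich_diag_index:
  assumes "V \<in> carrier_mat n n" "W \<in> carrier_mat n n" "i < n" "j < n"
  shows "(V * mat_diag n f * W) $$ (i, j) = (\<Sum>k<n. V $$ (i, k) * f k * W $$ (k, j))"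
  using assms by (simp add: mat_diag_mult_right[of _ n] scalar_prod_def atLeast0LessThan)

lemma mat_diag_pow: "mat_diag n f ^\<^sub>m k = mat_diag n (\<lambda>i. f i ^ k :: real)"
proof (induction k)
  case 0
  show ?case by (simp add: mat_diag_def one_mat_def cong: cong_mat)
next
  case (Suc k)
  then show ?case by (simp add: mult.commute)
qed

section \<open>Spectra and quadratic forms in an energy eigenbasis\<close>
context energy_eigenbasis
begin

lemma A_carrier [simp]: "A \<in> carrier_mat n n" and A_sym: "A\<^sup>T = A"
  using spd by (auto simp: spd_def)

lemmas square_mult [simp] = mult_carrier_mat[of _ n n _ n]

lemma B_carrier [simp]: "B \<in> carrier_mat n n"
  by (simp add: B_eq)

lemma V_inverse: "V\<^sup>T * A * V = 1\<^sub>m n" "V * (V\<^sup>T * A) = 1\<^sub>m n" "A * (V * V\<^sup>T) = 1\<^sub>m n"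
proof -
  show "V\<^sup>T * A * V = 1\<^sub>m n" by (rule orthonormal)
  show VVA: "V * (V\<^sup>T * A) = 1\<^sub>m n"
    using mat_mult_left_right_inverse[OF _ V orthonormal] mult_carrier_mat[of "V\<^sup>T" n n A n] by simp
  have "A * (V * V\<^sup>T) = (V * (V\<^sup>T * A))\<^sup>T"
    using V A_carrier by (simp add: transpose_mult[of _ n n _ n] assoc_mult_mat[of _ n n _ n _ n] A_sym
       )
  then show "A * (V * V\<^sup>T) = 1\<^sub>m n" by (simp add: VVA)
qed

lemma mat_inv_A: "mat_inv A = V * V\<^sup>T"
  by (rule mat_inv_eqI[of _ n]) (use mult_carrier_mat[of V n n "V\<^sup>T" n] in \<open>auto simp: V_inverse\<close>)

lemma similar_diag: "similar_mat_wit (B * A) (mat_diag n d) V (V\<^sup>T * A)"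
proof (rule similar_mat_witI)
  show "B * A = V * mat_diag n d * (V\<^sup>T * A)"
    unfolding B_eq by (rule assoc_mult_mat[of _ n n _ n _ n]) auto
  show "B * A \<in> carrier_mat n n" "V\<^sup>T * A \<in> carrier_mat n n"
    using mult_carrier_mat[of B n n A n] mult_carrier_mat[of "V\<^sup>T" n n A n] by auto
qed (auto simp: V_inverse)

lemma char_poly_eq: "char_poly (B * A) = (\<Prod>i<n. [:- d i, 1:])"
proof -
  have "char_poly (B * A) = char_poly (mat_diag n d)"
    using similar_diag by (intro char_poly_similar) (auto simp: similar_mat_def)
  also have "\<dots> = (\<Prod>a\<leftarrow>diag_mat (mat_diag n d). [:- a, 1:])"
    by (rule char_poly_upper_triangular[of _ n]) (auto simp: mat_diag_def)
  also have "diag_mat (mat_diag n d) = map d [0..<n]"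
    by (auto simp: diag_mat_def mat_diag_def)
  finally show ?thesis
    by (simp add: o_def prod.list_conv_set_nth atLeast0LessThan)
qed

lemma BA_carrier: "B * A \<in> carrier_mat n n"
  by (rule mult_carrier_mat[of _ n n]) auto

lemma spectrum_eq: "spectrum (B * A) = d ` {..<n}"
  by (auto simp: spectrum_root_char_poly[OF BA_carrier] char_poly_eq poly_prod)

lemma complex_spectrum_eq:
  "spectrum (map_mat complex_of_real (B * A)) = complex_of_real ` d ` {..<n}"
proof -
  interpret hom: map_poly_comm_ring_hom complex_of_real ..
  have C: "map_mat complex_of_real (B * A) \<in> carrier_mat n n" using BA_carrier by simp
  have "char_poly (map_mat complex_of_real (B * A)) = (\<Prod>i<n. [:- complex_of_real (d i), 1:])"
    by (simp add: of_real_hom.char_poly_hom[OF BA_carrier] char_poly_eq hom.hom_prod)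
  then show ?thesis
    by (auto simp: spectrum_root_char_poly[OF C] poly_prod)
qed

lemma quadratic_form:
  assumes u: "u \<in> carrier_vec n"
  shows "((V * mat_diag n f * V\<^sup>T) *\<^sub>v u) \<bullet> u = (\<Sum>i<n. f i * ((V\<^sup>T *\<^sub>v u) $ i)\<^sup>2)"
proof -
  define y where "y = V\<^sup>T *\<^sub>v u"
  have y: "y \<in> carrier_vec n" using u mult_mat_vec_carrier[of "V\<^sup>T" n n u] by (simp add: y_def)
  have Dy: "mat_diag n f *\<^sub>v y = vec n (\<lambda>i. f i * y $ i)"
  proof (intro eq_vecI)
    fix i assume i: "i < dim_vec (vec n (\<lambda>i. f i * y $ i))"
    have "(mat_diag n f *\<^sub>v y) $ i = (\<Sum>j\<in>{0..<n}. (if i = j then f j else 0) * y $ j)"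
      using i y by (simp add: mat_diag_def scalar_prod_def)
    also have "\<dots> = (\<Sum>j\<in>{0..<n}. if i = j then f j * y $ j else 0)"
      by (intro sum.cong) auto
    finally show "(mat_diag n f *\<^sub>v y) $ i = vec n (\<lambda>i. f i * y $ i) $ i" using i by simp
  qed (simp add: mat_diag_def)
  have "(V * mat_diag n f * V\<^sup>T) *\<^sub>v u = V *\<^sub>v (mat_diag n f *\<^sub>v y)"
    using u V y unfolding y_def
    by (simp add: assoc_mult_mat_vec[of _ n n _ n] assoc_mult_mat[of _ n n _ n _ n])
  also have "\<dots> \<bullet> u = (mat_diag n f *\<^sub>v y) \<bullet> y"
    using transpose_vec_mult_scalar[of "V\<^sup>T" n n u "mat_diag n f *\<^sub>v y"] u Dy
    by (simp add: y_def)
  finally show ?thesis using y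
    by (simp add: Dy scalar_prod_def power2_eq_square atLeast0LessThan mult.assoc flip: y_def)
qed

lemma quadratic_form_B:
  "u \<in> carrier_vec n \<Longrightarrow> (B *\<^sub>v u) \<bullet> u = (\<Sum>i<n. d i * ((V\<^sup>T *\<^sub>v u) $ i)\<^sup>2)"
  unfolding B_eq by (rule quadratic_form)

lemma quadratic_form_mat_inv:
  assumes "u \<in> carrier_vec n"
  shows "(mat_inv A *\<^sub>v u) \<bullet> u = (\<Sum>i<n. ((V\<^sup>T *\<^sub>v u) $ i)\<^sup>2)"
  using quadratic_form[OF assms, of "\<lambda>_. 1"] by (simp add: mat_inv_A right_mult_one_mat[OF V])

lemma B_sym: "B\<^sup>T = B"
  unfolding B_eq using V
  by (simp add: transpose_mult[of _ n n _ n] assoc_mult_mat[of _ n n _ n _ n])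

end

section \<open>Spectral bounds as comparisons of quadratic forms\<close>

text \<open>
  For symmetric positive definite \<open>A\<close> and symmetric \<open>B\<close>, these inequalities mean that all
  eigenvalues of \<open>B * A\<close> lie in \<open>{a..b}\<close>. The formulation by quadratic forms is chosen because,
  unlike eigenvalues, forms can be added and pulled back along a restriction, which is how a cycle is
  built from its coarse solver.
\<close>
definition spectral_bounds :: "nat \<Rightarrow> real mat \<Rightarrow> real mat \<Rightarrow> real \<Rightarrow> real \<Rightarrow> bool" where
  "spectral_bounds n A B a b \<longleftrightarrow> B \<in> carrier_mat n n \<and> B\<^sup>T = B \<and>
     (\<forall>u\<in>carrier_vec n. a * ((mat_inv A *\<^sub>v u) \<bullet> u) \<le> (B *\<^sub>v u) \<bullet> u \<and>
                        (B *\<^sub>v u) \<bullet> u \<le> b * ((mat_inv A *\<^sub>v u) \<bullet> u))"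

context energy_eigenbasis
begin

lemma spectral_bounds_iff: "spectral_bounds n A B a b \<longleftrightarrow> (\<forall>i<n. a \<le> d i \<and> d i \<le> b)"
proof
  assume *: "spectral_bounds n A B a b"
  show "\<forall>i<n. a \<le> d i \<and> d i \<le> b"
  proof (intro allI impI)
    fix i assume i: "i < n"
    \<comment> \<open>The vector whose coordinates \<open>V\<^sup>T u\<close> are those of the unit vector \<open>i\<close>.\<close>
    define u where "u = A *\<^sub>v col V i"
    have u: "u \<in> carrier_vec n"
      unfolding u_def by (rule mult_mat_vec_carrier[of _ n n]) (use V i in auto)
    have "V\<^sup>T *\<^sub>v u = col (V\<^sup>T * A * V) i"
      unfolding u_def using i V
      by (simp add: assoc_mult_mat[of _ n n _ n _ n] col_mult2[of _ n n _ n] del: col_mult)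
    then have "V\<^sup>T *\<^sub>v u = unit_vec n i" using i by (simp add: orthonormal)
    then have sq: "((V\<^sup>T *\<^sub>v u) $ j)\<^sup>2 = (if j = i then 1 else 0)"
      "d j * ((V\<^sup>T *\<^sub>v u) $ j)\<^sup>2 = (if j = i then d j else 0)" if "j < n" for j
      using i that by auto
    have "(mat_inv A *\<^sub>v u) \<bullet> u = 1" "(B *\<^sub>v u) \<bullet> u = d i"
      using u i sum.delta[of "{..<n}" i d] sum.delta[of "{..<n}" i "\<lambda>_. 1 :: real"] sq
      by (simp_all add: quadratic_form_mat_inv quadratic_form_B)
    then show "a \<le> d i \<and> d i \<le> b" using * u by (auto simp: spectral_bounds_def dest!: bspec[OF _ u])
  qed
next
  assume "\<forall>i<n. a \<le> d i \<and> d i \<le> b"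
  then show "spectral_bounds n A B a b"
    unfolding spectral_bounds_def
    by (auto simp: B_sym quadratic_form_B quadratic_form_mat_inv sum_distrib_left
        intro!: sum_mono mult_right_mono)
qed

lemma poly_mat_eq: "poly_mat p (B * A) = V * mat_diag n (\<lambda>i. poly p (d i)) * (V\<^sup>T * A)"
proof -
  have W: "V\<^sup>T * A \<in> carrier_mat n n" by (rule mult_carrier_mat[of _ n n]) auto
  have pow: "(B * A) ^\<^sub>m k = V * mat_diag n (\<lambda>i. d i ^ k) * (V\<^sup>T * A)" for k
    using similar_mat_wit_pow_id[OF similar_diag, of k] by (simp add: mat_diag_pow)
  note dim = carrier_matD(1)[OF BA_carrier]
  show ?thesis
  proof (intro eq_matI)
    fix i j
    assume "i < dim_row (V * mat_diag n (\<lambda>i. poly p (d i)) * (V\<^sup>T * A))"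
      and "j < dim_col (V * mat_diag n (\<lambda>i. poly p (d i)) * (V\<^sup>T * A))"
    then have ij: "i < n" "j < n" using carrier_matD[OF V] carrier_matD[OF A_carrier] by auto
    have "poly_mat p (B * A) $$ (i, j) = (\<Sum>k\<le>degree p. coeff p k *
        (\<Sum>a<n. V $$ (i, a) * d a ^ k * (V\<^sup>T * A) $$ (a, j)))"
      using ij by (simp only: poly_mat_def dim index_mat split pow sandwich_diag_index[OF V W])
    also have "\<dots> = (\<Sum>a<n. V $$ (i, a) * (\<Sum>k\<le>degree p. coeff p k * d a ^ k) * (V\<^sup>T * A) $$ (a, j))"
      unfolding sum_distrib_left sum_distrib_right
      by (subst sum.swap) (simp add: mult_ac)
    also have "\<dots> = (V * mat_diag n (\<lambda>i. poly p (d i)) * (V\<^sup>T * A)) $$ (i, j)"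
      unfolding sandwich_diag_index[OF V W ij] by (simp add: poly_altdef)
    finally show "poly_mat p (B * A) $$ (i, j)
        = (V * mat_diag n (\<lambda>i. poly p (d i)) * (V\<^sup>T * A)) $$ (i, j)" .
  qed (use carrier_matD[OF V] carrier_matD[OF A_carrier] carrier_matD[OF B_carrier]
       in \<open>simp_all add: poly_mat_def\<close>)
qed

text \<open>
  A polynomial of \<open>B * A\<close> acts on the eigenbasis through the values of the polynomial, so the
  corrected operator has the same eigenbasis.
\<close>
lemma polynomial_correction:
  "energy_eigenbasis n A V (\<lambda>i. 1 - poly p (d i)) ((1\<^sub>m n - poly_mat p (B * A)) * mat_inv A)"
proof
  define W where "W = V\<^sup>T * A"
  have W: "W \<in> carrier_mat n n" unfolding W_def by (rule mult_carrier_mat[of _ n n]) auto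
  have WV: "W * V = 1\<^sub>m n" and VW: "V * W = 1\<^sub>m n" by (simp_all add: W_def V_inverse)
  have D: "V * mat_diag n f * W \<in> carrier_mat n n" for f
    by (intro mult_carrier_mat[of _ n n] V W mat_diag_dim)
  have "1\<^sub>m n - poly_mat p (B * A) = V * mat_diag n (\<lambda>_. 1) * W - V * mat_diag n (\<lambda>i. poly p (d i)) * W"
    by (simp add: poly_mat_eq VW right_mult_one_mat[OF V] flip: W_def)
  also have "\<dots> = V * mat_diag n (\<lambda>i. 1 - poly p (d i)) * W"
  proof (intro eq_matI)
    fix i j assume "i < dim_row (V * mat_diag n (\<lambda>i. 1 - poly p (d i)) * W)"
      and "j < dim_col (V * mat_diag n (\<lambda>i. 1 - poly p (d i)) * W)"
    then have ij: "i < n" "j < n" using carrier_matD[OF D] by simp_all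
    show "(V * mat_diag n (\<lambda>_. 1) * W - V * mat_diag n (\<lambda>i. poly p (d i)) * W) $$ (i, j)
        = (V * mat_diag n (\<lambda>i. 1 - poly p (d i)) * W) $$ (i, j)"
      using ij carrier_matD[OF D]
      by (simp only: index_minus_mat sandwich_diag_index[OF V W])
        (simp add: algebra_simps sum_subtractf)
  qed (simp_all only: index_minus_mat carrier_matD[OF D])
  finally have "(1\<^sub>m n - poly_mat p (B * A)) * mat_inv A
      = V * mat_diag n (\<lambda>i. 1 - poly p (d i)) * W * (V * V\<^sup>T)" by (simp add: mat_inv_A)
  also have "\<dots> = V * mat_diag n (\<lambda>i. 1 - poly p (d i)) * ((W * V) * V\<^sup>T)"
    using V W by (simp add: assoc_mult_mat[of _ n n _ n _ n])
  finally show "(1\<^sub>m n - poly_mat p (B * A)) * mat_inv A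
      = V * mat_diag n (\<lambda>i. 1 - poly p (d i)) * V\<^sup>T"
    using V by (simp add: WV)
qed (use spd orthonormal in auto)

end

lemma spectral_bounds_iff_spectrum:
  assumes "spd n A" "B \<in> carrier_mat n n" "B\<^sup>T = B"
  shows "spectral_bounds n A B a b \<longleftrightarrow> spectrum (B * A) \<subseteq> {a..b}"
proof -
  obtain V d where "energy_eigenbasis n A V d B" using energy_eigenbasis_exists[OF assms] .
  then interpret energy_eigenbasis n A V d B .
  show ?thesis by (auto simp: spectral_bounds_iff spectrum_eq)
qed

lemma spectral_bounds_lambdaI:
  assumes "spd n A" "B \<in> carrier_mat n n" "B\<^sup>T = B"
    and "a \<le> lambda_min (B * A)" "lambda_max (B * A) \<le> b"
  shows "spectral_bounds n A B a b"
proof -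
  have BA: "B * A \<in> carrier_mat n n" using assms by (auto simp: spd_def)
  have "a \<le> x \<and> x \<le> b" if "x \<in> spectrum (B * A)" for x
    using assms(4,5) Min_le[OF card_finite_spectrum(1)[OF BA] that]
      Max_ge[OF card_finite_spectrum(1)[OF BA] that]
    by (simp add: lambda_min_def lambda_max_def)
  then show ?thesis unfolding spectral_bounds_iff_spectrum[OF assms(1-3)] by auto
qed

text \<open>
  Similarity to a real diagonal matrix also determines the complex spectrum; therefore no complex
  eigenvalues arise besides the real ones between \<open>a\<close> and \<open>b\<close>.
\<close>
lemma kappa_le_of_spectral_bounds:
  assumes n: "0 < n" and spd: "spd n A" and bounds: "spectral_bounds n A B a b" and a: "0 < a"
  shows "kappa_le (B * A) (b / a)"
proof -
  have "B \<in> carrier_mat n n" "B\<^sup>T = B" using bounds by (auto simp: spectral_bounds_def)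
  then obtain V d where "energy_eigenbasis n A V d B" using energy_eigenbasis_exists[OF spd] by metis
  then interpret energy_eigenbasis n A V d B .
  have d: "a \<le> d i" "d i \<le> b" if "i < n" for i using bounds that by (auto simp: spectral_bounds_iff)
  have ne: "d ` {..<n} \<noteq> {}" using n by auto
  have min: "a \<le> lambda_min (B * A)" and max: "lambda_max (B * A) \<le> b"
    using d ne by (auto simp: lambda_min_def lambda_max_def spectrum_eq)
  have "0 \<le> b" using d[OF n] a by linarith
  then have "b / a * a \<le> b / a * lambda_min (B * A)" using min a by (intro mult_left_mono) auto
  then have "lambda_max (B * A) \<le> b / a * lambda_min (B * A)" using max a by simp
  moreover have "spectrum (map_mat complex_of_real (B * A)) \<subseteq> complex_of_real ` {0<..}"
    using d a unfolding complex_spectrum_eq by (force intro!: imageI)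
  ultimately show ?thesis by (simp add: kappa_le_def)
qed

lemma spectral_bounds_polynomial_correction:
  assumes spd: "spd n A" and bounds: "spectral_bounds n A B a b"
    and p: "\<And>x. a \<le> x \<Longrightarrow> x \<le> b \<Longrightarrow> c \<le> 1 - poly p x \<and> 1 - poly p x \<le> e"
  shows "spectral_bounds n A ((1\<^sub>m n - poly_mat p (B * A)) * mat_inv A) c e"
proof -
  have "B \<in> carrier_mat n n" "B\<^sup>T = B" using bounds by (auto simp: spectral_bounds_def)
  then obtain V d where "energy_eigenbasis n A V d B" using energy_eigenbasis_exists[OF spd] by metis
  then interpret energy_eigenbasis n A V d B .
  show ?thesis
    using bounds p energy_eigenbasis.spectral_bounds_iff[OF polynomial_correction]
    by (simp add: spectral_bounds_iff)
qed

lemma spd_mat_inv: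
  assumes "spd n A"
  shows "mat_inv A \<in> carrier_mat n n" "(mat_inv A)\<^sup>T = mat_inv A"
    "A * mat_inv A = 1\<^sub>m n" "mat_inv A * A = 1\<^sub>m n"
    "\<And>u. u \<in> carrier_vec n \<Longrightarrow> 0 \<le> (mat_inv A *\<^sub>v u) \<bullet> u"
proof -
  obtain V d where "energy_eigenbasis n A V d (1\<^sub>m n)"
    using energy_eigenbasis_exists[OF assms, of "1\<^sub>m n"] by auto
  then interpret energy_eigenbasis n A V d "1\<^sub>m n" .
  show "mat_inv A \<in> carrier_mat n n" "(mat_inv A)\<^sup>T = mat_inv A" "A * mat_inv A = 1\<^sub>m n"
    using mult_carrier_mat[of V n n "V\<^sup>T" n]
    by (auto simp: mat_inv_A V_inverse transpose_mult[of _ n n _ n])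
  then show "mat_inv A * A = 1\<^sub>m n" using mat_mult_left_right_inverse[of A n "mat_inv A"] by simp
  show "0 \<le> (mat_inv A *\<^sub>v u) \<bullet> u" if "u \<in> carrier_vec n" for u
    by (simp add: quadratic_form_mat_inv[OF that] sum_nonneg)
qed

lemma spectral_bounds_mat_inv:
  assumes spd: "spd n A" and "a \<le> 1" "1 \<le> b"
  shows "spectral_bounds n A (mat_inv A) a b"
  using assms(2,3) spd_mat_inv[OF spd] mult_right_mono[of a 1] mult_right_mono[of 1 b]
  by (auto simp: spectral_bounds_def)

lemma spectral_bounds_mono:
  assumes spd: "spd n A" and "spectral_bounds n A B a b" "a' \<le> a" "b \<le> b'"
  shows "spectral_bounds n A B a' b'"
  unfolding spectral_bounds_def
proof (intro conjI ballI)
  fix u :: "real vec" assume u: "u \<in> carrier_vec n"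
  have "a' * ((mat_inv A *\<^sub>v u) \<bullet> u) \<le> a * ((mat_inv A *\<^sub>v u) \<bullet> u)"
    "b * ((mat_inv A *\<^sub>v u) \<bullet> u) \<le> b' * ((mat_inv A *\<^sub>v u) \<bullet> u)"
    using assms spd_mat_inv(5)[OF spd u] by (auto intro: mult_right_mono)
  then show "a' * ((mat_inv A *\<^sub>v u) \<bullet> u) \<le> (B *\<^sub>v u) \<bullet> u"
    "(B *\<^sub>v u) \<bullet> u \<le> b' * ((mat_inv A *\<^sub>v u) \<bullet> u)"
    using assms(2) u unfolding spectral_bounds_def by fastforce+
qed (use assms(2) in \<open>auto simp: spectral_bounds_def\<close>)


section \<open>The energy operator norm\<close>

text \<open>
  A supremum of reals bounds its members only if they are bounded above. Here a bound comes from the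
  eigenvalues of \<open>A\<inverse> * (X\<^sup>T * A * X)\<close>: the matrix \<open>B\<close> below is chosen such that its form
  at \<open>A w\<close> is the squared energy norm of \<open>X w\<close>, while the form of \<open>A\<inverse>\<close> at \<open>A w\<close> is the squared
  energy norm of \<open>w\<close>.
\<close>
lemma energy_norm_mult_le:
  assumes spd: "spd n A" and X: "X \<in> carrier_mat n n" and v: "v \<in> carrier_vec n"
  shows "energy_norm A (X *\<^sub>v v) \<le> energy_opnorm A X * energy_norm A v"
proof -
  note inv = spd_mat_inv[OF spd]
  have A: "A \<in> carrier_mat n n" and A_sym: "A\<^sup>T = A"
    and pos: "\<And>v. v \<in> carrier_vec n \<Longrightarrow> v \<noteq> 0\<^sub>v n \<Longrightarrow> 0 < (A *\<^sub>v v) \<bullet> v"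
    using spd by (auto simp: spd_def)
  note assoc = assoc_mult_mat[of _ n n _ n _ n]
  define B where "B = mat_inv A * (X\<^sup>T * A * X) * mat_inv A"
  have B: "B \<in> carrier_mat n n" using inv(1) A X by (simp add: B_def mult_carrier_mat[of _ n n _ n])
  have B_sym: "B\<^sup>T = B"
    using inv(1) A X
    by (simp add: B_def transpose_mult[of _ n n _ n] assoc inv(2) A_sym mult_carrier_mat[of _ n n _ n])
  obtain V d where "energy_eigenbasis n A V d B" using energy_eigenbasis_exists[OF spd B B_sym] .
  then interpret energy_eigenbasis n A V d B .
  define b where "b = (\<Sum>i<n. \<bar>d i\<bar>)"
  have d_le: "d i \<le> b" if "i < n" for i
    using member_le_sum[of i "{..<n}" "\<lambda>i. \<bar>d i\<bar>"] that by (simp add: b_def)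
  have "d i \<ge> - b" if "i < n" for i
    using member_le_sum[of i "{..<n}" "\<lambda>i. \<bar>d i\<bar>"] that by (simp add: b_def)
  then have B_le: "(B *\<^sub>v u) \<bullet> u \<le> b * ((mat_inv A *\<^sub>v u) \<bullet> u)" if "u \<in> carrier_vec n" for u
    using that d_le spectral_bounds_iff[of "- b" b] by (auto simp: spectral_bounds_def)
  have le: "(A *\<^sub>v (X *\<^sub>v w)) \<bullet> (X *\<^sub>v w) \<le> b * ((A *\<^sub>v w) \<bullet> w)" if w: "w \<in> carrier_vec n" for w
  proof -
    have Aw: "A *\<^sub>v w \<in> carrier_vec n" and Xw: "X *\<^sub>v w \<in> carrier_vec n"
      by (rule mult_mat_vec_carrier[OF A w], rule mult_mat_vec_carrier[OF X w])
    have inv_Aw: "mat_inv A *\<^sub>v (A *\<^sub>v w) = w"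
      using inv(1,4) A w by (simp flip: assoc_mult_mat_vec[of _ n n _ n])
    have AXw: "A *\<^sub>v (X *\<^sub>v w) \<in> carrier_vec n" by (rule mult_mat_vec_carrier[OF A Xw])
    have XAXw: "X\<^sup>T *\<^sub>v (A *\<^sub>v (X *\<^sub>v w)) \<in> carrier_vec n" using X AXw by simp
    have "B *\<^sub>v (A *\<^sub>v w) = mat_inv A *\<^sub>v (X\<^sup>T *\<^sub>v (A *\<^sub>v (X *\<^sub>v w)))"
      using inv(1) A X w Aw
      by (simp add: B_def assoc_mult_mat_vec[of _ n n _ n] inv_Aw mult_carrier_mat[of _ n n _ n])
    also have "\<dots> \<bullet> (A *\<^sub>v w) = (X\<^sup>T *\<^sub>v (A *\<^sub>v (X *\<^sub>v w))) \<bullet> w"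
      using transpose_vec_mult_scalar[OF inv(1) Aw XAXw] by (simp add: inv(2) inv_Aw)
    also have "\<dots> = (A *\<^sub>v (X *\<^sub>v w)) \<bullet> (X *\<^sub>v w)"
      by (rule transpose_vec_mult_scalar[OF X w AXw])
    finally show ?thesis
      using B_le[OF Aw] comm_scalar_prod[OF w Aw] by (simp add: inv_Aw)
  qed
  have nonneg: "0 \<le> (A *\<^sub>v w) \<bullet> w" if "w \<in> carrier_vec n" for w
    using pos[OF that] scalar_prod_right_zero[OF mult_mat_vec_carrier[OF A that]]
    by (cases "w = 0\<^sub>v n") (auto intro: less_imp_le)
  have zero: "energy_norm A (0\<^sub>v n) = 0"
    using scalar_prod_right_zero[OF mult_mat_vec_carrier[OF A zero_carrier_vec]]
    by (simp add: energy_norm_def)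
  have norm_le: "energy_norm A (X *\<^sub>v w) \<le> sqrt b * energy_norm A w" if w: "w \<in> carrier_vec n" for w
    using le[OF w] by (simp add: energy_norm_def flip: real_sqrt_mult)
  have quot: "energy_norm A (X *\<^sub>v w) / energy_norm A w \<le> sqrt b" if w: "w \<in> carrier_vec n" for w
  proof (cases "w = 0\<^sub>v n")
    case True
    have "0 \<le> b" by (simp add: b_def sum_nonneg)
    then show ?thesis by (simp add: True zero)
  next
    case False
    then show ?thesis
      using norm_le[OF w] pos[OF w False] by (simp add: energy_norm_def pos_divide_le_eq)
  qed
  have "bdd_above ((\<lambda>w. energy_norm A (X *\<^sub>v w) / energy_norm A w) ` carrier_vec (dim_col X))"
    using quot X by (intro bdd_aboveI2[where M = "sqrt b"]) auto
  then have quot_le: "energy_norm A (X *\<^sub>v v) / energy_norm A v \<le> energy_opnorm A X"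
    using v X unfolding energy_opnorm_def by (intro cSUP_upper) auto
  show ?thesis
  proof (cases "v = 0\<^sub>v n")
    case True
    then show ?thesis using norm_le[OF v] by (simp add: zero)
  next
    case False
    then show ?thesis
      using quot_le pos[OF v] by (simp add: energy_norm_def pos_divide_le_eq)
  qed
qed

section \<open>Smoothing and the symmetrized cycle\<close>
lemma Mbar_eq:
  assumes A: "A \<in> carrier_mat n n" and M: "M \<in> carrier_mat n n" and inv: "invertible_mat M"
  shows "Mbar A M = M + M\<^sup>T - M\<^sup>T * A * M"
proof -
  note MI = mat_inv_right_left[OF M inv]
  let ?I = "mat_inv M"
  have IT: "?I\<^sup>T \<in> carrier_mat n n" "M\<^sup>T \<in> carrier_mat n n" using MI M by auto
  have MMI: "M\<^sup>T * ?I\<^sup>T = 1\<^sub>m n"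
    using MI M transpose_mult[of ?I n n M n] by simp
  have "Mbar A M = M\<^sup>T * (?I + ?I\<^sup>T) * M - M\<^sup>T * A * M"
    unfolding Mbar_def using MI(1) IT M A
    by (simp add: mult_minus_distrib_mat[of _ n n _ n] minus_mult_distrib_mat[of _ n n _ _ n]
        mult_carrier_mat[of _ n n _ n])
  also have "M\<^sup>T * (?I + ?I\<^sup>T) * M = M\<^sup>T * (?I * M) + (M\<^sup>T * ?I\<^sup>T) * M"
    using MI(1) IT M
    by (simp add: mult_add_distrib_mat[of _ n n _ n] add_mult_distrib_mat[of _ n n _ _ n]
        mult_carrier_mat[of _ n n _ n] assoc_mult_mat[of _ n n _ n _ n])
  also have "\<dots> = M + M\<^sup>T" using MI M MMI IT by (simp add: comm_add_mat[of _ n n])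
  finally show ?thesis .
qed

lemma Mbar_symmetric:
  assumes A: "A \<in> carrier_mat n n" "A\<^sup>T = A" and M: "M \<in> carrier_mat n n" and inv: "invertible_mat M"
  shows "Mbar A M \<in> carrier_mat n n" "(Mbar A M)\<^sup>T = Mbar A M"
proof -
  have MT: "M\<^sup>T \<in> carrier_mat n n" and P: "M\<^sup>T * A * M \<in> carrier_mat n n"
    using A M by (simp_all add: mult_carrier_mat[of _ n n _ n])
  show "Mbar A M \<in> carrier_mat n n" unfolding Mbar_eq[OF A(1) M inv] by (rule minus_carrier_mat[OF P])
  have "(M\<^sup>T * A * M)\<^sup>T = M\<^sup>T * A * M"
    using A M by (simp add: transpose_mult[of _ n n _ n] assoc_mult_mat[of _ n n _ n _ n]
        mult_carrier_mat[of _ n n _ n])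
  then show "(Mbar A M)\<^sup>T = Mbar A M"
    unfolding Mbar_eq[OF A(1) M inv] using P M MT
    by (simp add: transpose_minus[of _ n n] transpose_add[of _ n n] comm_add_mat[of _ n n])
qed

text \<open>
  The identity \<open>1 - Mbar A M * A = (1 - M\<^sup>T * A) * (1 - M * A)\<close>, evaluated in the energy inner product
  at \<open>v = A\<inverse> u\<close>, reads \<open>(Mbar A M u, u) = \<parallel>v\<parallel>\<^sup>2 - \<parallel>(1 - M * A) v\<parallel>\<^sup>2\<close> in energy norms. The right-hand
  side is nonnegative for a nonexpansive smoother.
\<close>
lemma Mbar_nonneg:
  assumes spd: "spd n A" and M: "M \<in> carrier_mat n n" and inv: "invertible_mat M"
    and nonexpansive: "energy_opnorm A (1\<^sub>m n - M * A) \<le> 1" and u: "u \<in> carrier_vec n"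
  shows "0 \<le> (Mbar A M *\<^sub>v u) \<bullet> u"
proof -
  have A: "A \<in> carrier_mat n n" and A_sym: "A\<^sup>T = A" using spd by (auto simp: spd_def)
  note Ainv = spd_mat_inv[OF spd]
  define v where "v = mat_inv A *\<^sub>v u"
  define w where "w = M *\<^sub>v u"
  have v: "v \<in> carrier_vec n" and w: "w \<in> carrier_vec n" using Ainv M u by (auto simp: v_def w_def)
  have Av: "A *\<^sub>v v = u" using Ainv A u by (simp add: v_def flip: assoc_mult_mat_vec[of _ n n _ n])
  have Aw: "A *\<^sub>v w \<in> carrier_vec n" using A w by simp
  have MA: "M * A \<in> carrier_mat n n" using M A by simp
  have e: "(1\<^sub>m n - M * A) *\<^sub>v v = v - w"
    using M A v MA by (simp add: minus_mult_distrib_mat_vec[of _ n n] assoc_mult_mat_vec[of _ n n _ n] Av w_def)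
  have "energy_norm A (v - w) \<le> energy_opnorm A (1\<^sub>m n - M * A) * energy_norm A v"
    using energy_norm_mult_le[OF spd minus_carrier_mat[OF MA] v, of "1\<^sub>m n"] e by simp
  also have "\<dots> \<le> 1 * energy_norm A v"
    using Ainv(5)[OF u] comm_scalar_prod[OF v u]
    by (intro mult_right_mono nonexpansive) (simp add: energy_norm_def Av flip: v_def)
  finally have "(A *\<^sub>v (v - w)) \<bullet> (v - w) \<le> u \<bullet> v"
    by (simp add: energy_norm_def Av)
  moreover have "(A *\<^sub>v (v - w)) \<bullet> (v - w) = u \<bullet> v - u \<bullet> w - ((A *\<^sub>v w) \<bullet> v - (A *\<^sub>v w) \<bullet> w)"
    using A v w u Aw Av
    by (simp add: mult_minus_distrib_mat_vec[of _ n n] minus_scalar_prod_distrib[of _ n]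
        scalar_prod_minus_distrib[of _ n])
  moreover have "(A *\<^sub>v w) \<bullet> v = w \<bullet> u"
    using transpose_vec_mult_scalar[OF A v w] by (simp add: A_sym Av)
  moreover have "u \<bullet> w = w \<bullet> u" by (rule comm_scalar_prod[OF u w])
  moreover have "(Mbar A M *\<^sub>v u) \<bullet> u = w \<bullet> u + w \<bullet> u - (A *\<^sub>v w) \<bullet> w"
  proof -
    have MT: "M\<^sup>T \<in> carrier_mat n n" "M\<^sup>T * A * M \<in> carrier_mat n n" "M + M\<^sup>T \<in> carrier_mat n n"
      using A M by (simp_all add: mult_carrier_mat[of _ n n _ n])
    have MTu: "M\<^sup>T *\<^sub>v u \<in> carrier_vec n" and MTAw: "M\<^sup>T *\<^sub>v (A *\<^sub>v w) \<in> carrier_vec n"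
      using MT u Aw by auto
    have "Mbar A M *\<^sub>v u = w + M\<^sup>T *\<^sub>v u - M\<^sup>T *\<^sub>v (A *\<^sub>v w)"
      unfolding Mbar_eq[OF A M inv] w_def using MT A M u
      by (simp add: minus_mult_distrib_mat_vec[of _ n n] add_mult_distrib_mat_vec[of _ n n]
          assoc_mult_mat_vec[of _ n n _ n] mult_carrier_mat[of _ n n _ n])
    then have "(Mbar A M *\<^sub>v u) \<bullet> u = w \<bullet> u + (M\<^sup>T *\<^sub>v u) \<bullet> u - (M\<^sup>T *\<^sub>v (A *\<^sub>v w)) \<bullet> u"
      using w MTu MTAw u
      by (simp add: minus_scalar_prod_distrib[of _ n] add_scalar_prod_distrib[of _ n])
    also have "(M\<^sup>T *\<^sub>v u) \<bullet> u = w \<bullet> u"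
      using transpose_vec_mult_scalar[OF M u u] comm_scalar_prod[OF u w] by (simp add: w_def)
    also have "(M\<^sup>T *\<^sub>v (A *\<^sub>v w)) \<bullet> u = (A *\<^sub>v w) \<bullet> w"
      using transpose_vec_mult_scalar[OF M u Aw] by (simp add: w_def)
    finally show ?thesis .
  qed
  ultimately show ?thesis by linarith
qed

text \<open>
  The coarse part of the cycle is \<open>K\<^sup>T * C * K\<close> with the restriction of the presmoothed residual
  \<open>K = P\<^sup>T * (1 - A * M)\<close>, so its form is the form of \<open>C\<close> at \<open>K u\<close>.
\<close>
lemma cycle_op_symmetric:
  assumes A: "A \<in> carrier_mat n n" "A\<^sup>T = A" and M: "M \<in> carrier_mat n n" "invertible_mat M"
    and P: "P \<in> carrier_mat n m" and C: "C \<in> carrier_mat m m" "C\<^sup>T = C"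
  shows "cycle_op A M P C \<in> carrier_mat n n" "(cycle_op A M P C)\<^sup>T = cycle_op A M P C"
    and "u \<in> carrier_vec n \<Longrightarrow> (cycle_op A M P C *\<^sub>v u) \<bullet> u = (Mbar A M *\<^sub>v u) \<bullet> u +
      (C *\<^sub>v (P\<^sup>T *\<^sub>v ((1\<^sub>m n - A * M) *\<^sub>v u))) \<bullet> (P\<^sup>T *\<^sub>v ((1\<^sub>m n - A * M) *\<^sub>v u))"
proof -
  define K where "K = P\<^sup>T * (1\<^sub>m n - A * M)"
  have AM: "A * M \<in> carrier_mat n n" using A M by simp
  have D: "1\<^sub>m n - A * M \<in> carrier_mat n n" and PT: "P\<^sup>T \<in> carrier_mat m n"
    using minus_carrier_mat[OF AM] P by auto
  have DT: "(1\<^sub>m n - A * M)\<^sup>T = 1\<^sub>m n - M\<^sup>T * A"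
    using A M AM by (simp add: transpose_minus[of _ n n] transpose_mult[of _ n n _ n])
  have K: "K \<in> carrier_mat m n" unfolding K_def using PT D by (rule mult_carrier_mat)
  have KT: "K\<^sup>T = (1\<^sub>m n - M\<^sup>T * A) * P"
    unfolding K_def by (simp add: transpose_mult[OF PT D] DT)
  have KTc: "K\<^sup>T \<in> carrier_mat n m" using K by simp
  have CK: "C * K \<in> carrier_mat m n" using C K by simp
  have KCK: "K\<^sup>T * (C * K) \<in> carrier_mat n n" using KTc CK by simp
  have KC: "K\<^sup>T * C \<in> carrier_mat n m" using KTc C by simp
  note Mb = Mbar_symmetric[OF A M]
  have dim: "dim_row A = n" using A by simp
  have "(1\<^sub>m n - M\<^sup>T * A) * P * C * P\<^sup>T * (1\<^sub>m n - A * M) = K\<^sup>T * C * P\<^sup>T * (1\<^sub>m n - A * M)"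
    by (simp add: KT)
  also have "\<dots> = K\<^sup>T * C * K" unfolding K_def using KC PT D K_def by (intro assoc_mult_mat) auto
  also have "\<dots> = K\<^sup>T * (C * K)" by (rule assoc_mult_mat[OF KTc C(1) K])
  finally have eq: "cycle_op A M P C = Mbar A M + K\<^sup>T * (C * K)"
    by (simp add: cycle_op_def dim)
  show "cycle_op A M P C \<in> carrier_mat n n" unfolding eq using Mb KCK by simp
  have "(K\<^sup>T * (C * K))\<^sup>T = K\<^sup>T * (C * K)"
    using transpose_mult[OF KTc CK] transpose_mult[OF C(1) K] assoc_mult_mat[OF KTc C(1) K] C by simp
  then show "(cycle_op A M P C)\<^sup>T = cycle_op A M P C"
    unfolding eq by (simp add: transpose_add[OF Mb(1) KCK] Mb)
  assume u: "u \<in> carrier_vec n"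
  have Ku: "K *\<^sub>v u = P\<^sup>T *\<^sub>v ((1\<^sub>m n - A * M) *\<^sub>v u)"
    unfolding K_def by (rule assoc_mult_mat_vec[OF PT D u])
  have Kuc: "K *\<^sub>v u \<in> carrier_vec m" and CKuc: "C *\<^sub>v (K *\<^sub>v u) \<in> carrier_vec m"
    using K C u by auto
  have "cycle_op A M P C *\<^sub>v u = Mbar A M *\<^sub>v u + K\<^sup>T *\<^sub>v (C *\<^sub>v (K *\<^sub>v u))"
    unfolding eq using add_mult_distrib_mat_vec[OF Mb(1) KCK u] assoc_mult_mat_vec[OF KTc CK u]
      assoc_mult_mat_vec[OF C(1) K u] by simp
  also have "\<dots> \<bullet> u = (Mbar A M *\<^sub>v u) \<bullet> u + (K\<^sup>T *\<^sub>v (C *\<^sub>v (K *\<^sub>v u))) \<bullet> u"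
    using Mb u KTc CKuc by (intro add_scalar_prod_distrib[of _ n]) auto
  also have "(K\<^sup>T *\<^sub>v (C *\<^sub>v (K *\<^sub>v u))) \<bullet> u = (C *\<^sub>v (K *\<^sub>v u)) \<bullet> (K *\<^sub>v u)"
    by (rule transpose_vec_mult_scalar[OF K u CKuc])
  finally show "(cycle_op A M P C *\<^sub>v u) \<bullet> u = (Mbar A M *\<^sub>v u) \<bullet> u +
      (C *\<^sub>v (P\<^sup>T *\<^sub>v ((1\<^sub>m n - A * M) *\<^sub>v u))) \<bullet> (P\<^sup>T *\<^sub>v ((1\<^sub>m n - A * M) *\<^sub>v u))"
    unfolding Ku .
qed

text \<open>
  Replacing the exact coarse solver by \<open>C\<close> changes only the coarse part of the form, by a factor
  between \<open>c\<close> and \<open>e\<close>. Because the smoothing part is nonnegative and \<open>c \<le> 1 \<le> e\<close>, the whole form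
  changes by a factor between \<open>c\<close> and \<open>e\<close>, so that the two-grid bounds \<open>t\<close> and \<open>s\<close> are multiplied
  by these factors.
\<close>
lemma cycle_op_spectral_bounds:
  assumes spd: "spd n A" and coarse: "spd m A'"
    and M: "M \<in> carrier_mat n n" "invertible_mat M"
    and nonexpansive: "energy_opnorm A (1\<^sub>m n - M * A) \<le> 1"
    and P: "P \<in> carrier_mat n m"
    and two_grid: "spectral_bounds n A (cycle_op A M P (mat_inv A')) t s"
    and C: "spectral_bounds m A' C c e" and c: "0 \<le> c" "c \<le> 1" and e: "1 \<le> e"
  shows "spectral_bounds n A (cycle_op A M P C) (c * t) (e * s)"
proof -
  have A: "A \<in> carrier_mat n n" "A\<^sup>T = A" using spd by (auto simp: spd_def)
  have C_sym: "C \<in> carrier_mat m m" "C\<^sup>T = C" using C by (auto simp: spectral_bounds_def)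
  note cyc = cycle_op_symmetric[OF A M P C_sym]
  note tg = cycle_op_symmetric(3)[OF A M P spd_mat_inv(1,2)[OF coarse]]
  show ?thesis unfolding spectral_bounds_def
  proof (intro conjI ballI cyc)
    fix u :: "real vec" assume u: "u \<in> carrier_vec n"
    define w where "w = P\<^sup>T *\<^sub>v ((1\<^sub>m n - A * M) *\<^sub>v u)"
    have "1\<^sub>m n - A * M \<in> carrier_mat n n"
      using minus_carrier_mat[OF mult_carrier_mat[OF A(1) M(1)]] .
    then have "(1\<^sub>m n - A * M) *\<^sub>v u \<in> carrier_vec n" using u by (rule mult_mat_vec_carrier)
    then have w: "w \<in> carrier_vec m"
      unfolding w_def using P by (intro mult_mat_vec_carrier[of _ m n]) auto
    let ?m = "(Mbar A M *\<^sub>v u) \<bullet> u" and ?q = "(mat_inv A' *\<^sub>v w) \<bullet> w"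
    have m: "0 \<le> ?m" by (rule Mbar_nonneg[OF spd M nonexpansive u])
    have Cw: "c * ?q \<le> (C *\<^sub>v w) \<bullet> w" "(C *\<^sub>v w) \<bullet> w \<le> e * ?q"
      using C w by (auto simp: spectral_bounds_def)
    have tg_u: "t * ((mat_inv A *\<^sub>v u) \<bullet> u) \<le> ?m + ?q" "?m + ?q \<le> s * ((mat_inv A *\<^sub>v u) \<bullet> u)"
      using two_grid u tg[OF u] by (auto simp: spectral_bounds_def w_def)
    have "c * (t * ((mat_inv A *\<^sub>v u) \<bullet> u)) \<le> c * ?m + c * ?q"
      using mult_left_mono[OF tg_u(1) c(1)] by (simp add: distrib_left)
    also have "\<dots> \<le> ?m + (C *\<^sub>v w) \<bullet> w" using Cw(1) mult_right_mono[OF c(2) m] by simp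
    finally show "c * t * ((mat_inv A *\<^sub>v u) \<bullet> u) \<le> (cycle_op A M P C *\<^sub>v u) \<bullet> u"
      by (simp add: cyc(3)[OF u] mult.assoc flip: w_def)
    have "?m + (C *\<^sub>v w) \<bullet> w \<le> e * ?m + e * ?q" using Cw(2) mult_right_mono[OF e m] by simp
    also have "\<dots> \<le> e * (s * ((mat_inv A *\<^sub>v u) \<bullet> u))"
      using mult_left_mono[OF tg_u(2), of e] e by (simp add: distrib_left)
    finally show "(cycle_op A M P C *\<^sub>v u) \<bullet> u \<le> e * s * ((mat_inv A *\<^sub>v u) \<bullet> u)"
      by (simp add: cyc(3)[OF u] mult.assoc flip: w_def)
  qed
qed

section \<open>The correction polynomial\<close>

text \<open>
  Division by \<open>L\<close> maps \<open>{\<mu>..L}\<close> into \<open>{\<mu> / L..1}\<close> with \<open>\<mu> / L \<le> \<nu>\<close>. Up to \<open>\<nu>\<close> the polynomial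
  \<open>pt\<close> decreases and beyond \<open>\<nu>\<close> it stays below its value at \<open>\<nu>\<close>; so it is largest at \<open>\<mu> / L\<close>. The
  upper bound is the definition of \<open>L\<close>.
\<close>
lemma correction_polynomial_bounds:
  fixes pt p :: "real poly" and \<nu> L \<mu> x :: real
  assumes \<nu>: "0 < \<nu>" "\<nu> < 1"
    and decreasing: "antimono_on {0<..\<nu>} (poly pt)"
    and sup: "(SUP x\<in>{\<nu>..1}. poly pt x) \<le> poly pt \<nu>"
    and L: "L = max 1 (1 - (INF x\<in>{0<..1}. poly pt x))"
    and p: "p = pcompose pt [:0, 1 / L:]"
    and \<mu>: "0 < \<mu>" "\<mu> \<le> L * \<nu>"
    and x: "\<mu> \<le> x" "x \<le> L"
  shows "1 - poly p \<mu> \<le> 1 - poly p x" and "1 - poly p x \<le> L"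
proof -
  have "1 \<le> L" by (simp add: L)
  then have L0: "0 < L" by simp
  have bdd: "bdd_above (poly q ` {a..b})" if "a \<le> b" for q :: "real poly" and a b
    using isCont_bounded[OF that, of "poly q"] by (fastforce simp: bdd_above_def)
  have bdd_above: "bdd_above (poly pt ` {\<nu>..1})" using \<nu> by (intro bdd) simp
  obtain K where K: "\<forall>z\<in>{0..1}. poly (- pt) z \<le> K"
    using bdd[of 0 1 "- pt"] by (auto simp: bdd_above_def)
  have bdd_below: "bdd_below (poly pt ` {0<..1})"
    using K by (intro bdd_belowI2[where m = "- K"]) (force simp: minus_le_iff)
  have poly_p: "poly p y = poly pt (y / L)" for y by (simp add: p poly_pcompose)
  have xL: "x / L \<in> {0<..1}" and \<mu>L: "\<mu> / L \<in> {0<..\<nu>}" and le: "\<mu> / L \<le> x / L"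
    using x \<mu> L0 by (auto simp: field_simps)
  have "(INF x\<in>{0<..1}. poly pt x) \<le> poly pt (x / L)" by (rule cINF_lower[OF bdd_below xL])
  then show "1 - poly p x \<le> L" by (simp add: L poly_p)
  have dec: "poly pt z \<le> poly pt (\<mu> / L)" if "\<mu> / L \<le> z" "z \<le> \<nu>" for z
    using decreasing \<mu>L that by (auto simp: monotone_on_def)
  have "poly pt (x / L) \<le> poly pt (\<mu> / L)"
  proof (cases "x / L \<le> \<nu>")
    case True
    then show ?thesis using dec le by blast
  next
    case False
    then have "poly pt (x / L) \<le> (SUP x\<in>{\<nu>..1}. poly pt x)"
      using xL by (intro cSUP_upper bdd_above) auto
    also have "\<dots> \<le> poly pt (\<mu> / L)" using sup dec[of \<nu>] \<mu>L by simp
    finally show ?thesis .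
  qed
  then show "1 - poly p \<mu> \<le> 1 - poly p x" by (simp add: poly_p)
qed

section \<open>Condition numbers of the AMLI operators\<close>
theorem theorem4:
  fixes J :: nat
    and n :: "nat \<Rightarrow> nat"
    and A M P :: "nat \<Rightarrow> real mat"
    and \<delta> \<nu> L \<mu> :: real
    and pt p :: "real poly"
  assumes "2 \<le> J"
    and "\<And>l. l \<in> {1..J} \<Longrightarrow> 0 < n l"
    and "\<And>l. l \<in> {1..J} \<Longrightarrow> spd (n l) (A l)"
    and "\<And>l. l \<in> {1..<J} \<Longrightarrow> P l \<in> carrier_mat (n l) (n (Suc l))"
    and "\<And>l. l \<in> {1..<J} \<Longrightarrow> A (Suc l) = (P l)\<^sup>T * A l * P l"
    and "\<And>l. l \<in> {1..<J} \<Longrightarrow> M l \<in> carrier_mat (n l) (n l)"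
    and "\<And>l. l \<in> {1..<J} \<Longrightarrow> invertible_mat (M l)"
    and "\<And>l. l \<in> {1..<J} \<Longrightarrow> energy_opnorm (A l) (1\<^sub>m (n l) - M l * A l) \<le> 1"
    and "two_grid_uniform J A M P \<delta>"
    and "poly pt 0 = 1"
    and "0 < \<nu>" and "\<nu> < 1"
    and "0 \<le> poly pt \<nu>"
    and "antimono_on {0<..\<nu>} (poly pt)"
    and "(SUP x\<in>{\<nu>..1}. poly pt x) \<le> poly pt \<nu>"
    and "L = max 1 (1 - (INF x\<in>{0<..1}. poly pt x))"
    and "p = pcompose pt [:0, 1 / L:]"
    and "0 < \<mu>" and "\<mu> \<le> min (L * \<nu>) (1 - \<delta>)"
    and "\<mu> \<le> (1 - \<delta>) * (1 - poly p \<mu>)"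
  shows "\<forall>l\<in>{1..J}. kappa_le (amli_B J A M P p l * A l) (L / \<mu>)"
proof -
  note spd = assms(3) and P = assms(4) and M = assms(6,7,8)
  define c where "c = 1 - poly p \<mu>"
  have \<delta>: "0 \<le> \<delta>" "\<delta> < 1"
    and tg: "l \<in> {1..<J} \<Longrightarrow> 1 - \<delta> \<le> lambda_min (two_grid_op A M P l * A l) \<and>
      lambda_max (two_grid_op A M P l * A l) \<le> 1" for l
    using assms(9) by (auto simp: two_grid_uniform_def)
  have \<mu>: "0 < \<mu>" "\<mu> \<le> L * \<nu>" "\<mu> \<le> 1" "\<mu> \<le> c * (1 - \<delta>)"
    using assms \<delta> by (simp_all add: c_def mult.commute)
  have L: "1 \<le> L" using assms(16) by simp
  note p_bounds = correction_polynomial_bounds[OF assms(11,12,14,15,16,17) \<mu>(1,2), folded c_def]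
  have c: "0 \<le> c" using \<mu> \<delta> by (smt (verit) mult_nonpos_nonneg)
  \<comment> \<open>At \<open>\<mu> / L \<le> \<nu>\<close> the decreasing \<open>pt\<close> is at least \<open>pt \<nu> \<ge> 0\<close>; this gives \<open>c \<le> 1\<close>, without which
    the smoothing part could not absorb the factor \<open>c\<close>.\<close>
  have "0 \<le> poly p \<mu>"
  proof -
    have "\<mu> / L \<in> {0<..\<nu>}" "\<nu> \<in> {0<..\<nu>}" using \<mu> L assms(11) by (auto simp: field_simps)
    then have "poly pt \<nu> \<le> poly pt (\<mu> / L)" using assms(14) by (auto simp: monotone_on_def)
    then show ?thesis using assms(13) by (simp add: assms(17) poly_pcompose)
  qed
  then have c1: "c \<le> 1" by (simp add: c_def)
  have two_grid: "spectral_bounds (n l) (A l) (two_grid_op A M P l) (1 - \<delta>) 1" if l: "l \<in> {1..<J}" for l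
  proof (rule spectral_bounds_lambdaI)
    have l': "l \<in> {1..J}" "Suc l \<in> {1..J}" using l by auto
    show spd_l: "spd (n l) (A l)" by (rule spd[OF l'(1)])
    note sym = cycle_op_symmetric(1,2)[of "A l" "n l", OF _ _ M(1,2)[OF l] P[OF l] spd_mat_inv(1,2)[OF spd[OF l'(2)]]]
    show "two_grid_op A M P l \<in> carrier_mat (n l) (n l)" "(two_grid_op A M P l)\<^sup>T = two_grid_op A M P l"
      unfolding two_grid_op_def using sym spd_l by (auto simp: spd_def)
  qed (use tg[OF l] in auto)
  have hat: "spectral_bounds (n l) (A l) (amli_Bhat J A M P p l) c L"
    if l: "l \<in> {1..J}" and B: "spectral_bounds (n l) (A l) (amli_B J A M P p l) \<mu> L" for l
  proof (cases "l < J")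
    case True
    have "dim_row (A l) = n l" using spd[OF l] by (auto simp: spd_def)
    then show ?thesis
      using spectral_bounds_polynomial_correction[OF spd[OF l] B, of c p L] p_bounds True
      by (subst amli_Bhat.simps) auto
  next
    case False
    then show ?thesis
      using spectral_bounds_mat_inv[OF spd[OF l] c1 L] by (subst amli_Bhat.simps) auto
  qed
  \<comment> \<open>Induction from the coarsest level down to the finest.\<close>
  have bounds: "spectral_bounds (n l) (A l) (amli_B J A M P p l) \<mu> L" if "l \<le> J" "1 \<le> l" for l
    using that
  proof (induction l rule: inc_induct)
    case base
    then show ?case
      using spectral_bounds_mat_inv[OF spd \<mu>(3) L, of J] by (subst amli_B.simps) auto
  next
    case (step l)
    have l: "l \<in> {1..<J}" "l \<in> {1..J}" "Suc l \<in> {1..J}" using step by auto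
    have "spectral_bounds (n l) (A l) (cycle_op (A l) (M l) (P l) (amli_Bhat J A M P p (Suc l)))
        (c * (1 - \<delta>)) (L * 1)"
      using two_grid[OF l(1)] hat[OF l(3)] step c c1 L
      by (intro cycle_op_spectral_bounds[OF spd[OF l(2)] spd[OF l(3)] M(1-3)[OF l(1)] P[OF l(1)]])
        (auto simp: two_grid_op_def)
    then have "spectral_bounds (n l) (A l) (cycle_op (A l) (M l) (P l) (amli_Bhat J A M P p (Suc l))) \<mu> L"
      by (rule spectral_bounds_mono[OF spd[OF l(2)]]) (use \<mu> in auto)
    then show ?case using l by (subst amli_B.simps) auto
  qed
  show ?thesis
    using kappa_le_of_spectral_bounds[OF assms(2) spd bounds \<mu>(1)] by auto
qed

end
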